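(* Let $\alpha>1$, let $(M^m,g)$ be a compact, orientable Riemannian manifold without boundary of dimension $m>2$, let $(N^n,h)$ be a Riemannian manifold, and let $\psi:(M^m,g)\longrightarrow (N^n,h)$ be a non-degenerate smooth map. Then $\psi:(M,g)\to(N,h)$ is $\alpha$-harmonic if and only if $\psi:(M,\bar g)\to(N,h)$ is harmonic, where $\bar g$ is the metric conformally related to $g$ defined by $$\bar g=\left\{(2\alpha)^{\frac{2}{m-2}}\left(1+|d\psi|^2\right)^{\frac{2\alpha-2}{m-2}}\right\}g ,$$ with $|d\psi|$ computed with respect to $g$ and $h$.
   Context: For a smooth map $\psi:(M,g)\to(N,h)$, $|d\psi|^2=\sum_i h(d\psi(e_i),d\psi(e_i))$ (for a local $g$-orthonormal frame $\{e_i\}$) is the squared Hilbert-Schmidt norm of $d\psi$. The tension field is $\tau(\psi)=\mathrm{Tr}_g\nabla d\psi\in\Gamma(\psi^{-1}TN)$, and $\psi$ is harmonic if $\tau(\psi)=0$. For $\alpha>1$ the $\alpha$-energy is $E_\alpha(\psi)=\int_M(1+|d\psi|^2)^\alpha\,dV_g$; $\psi$ is $\alpha$-harmonic if it is a critical point of $E_\alpha$, equivalently if the $\alpha$-tension field $$\tau_\alpha(\psi)=2\alpha(1+|d\psi|^2)^{\alpha-1}\tau(\psi)+d\psi\left(\mathrm{grad}\left(2\alpha(1+|d\psi|^2)^{\alpha-1}\right)\right)$$ vanishes. The map $\psi$ is non-degenerate if $\ker d\psi_x=\{0\}$ at every point $x\in M$. *)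

theory Defs
  imports "HOL-Analysis.Analysis"
begin

section \<open>Smooth functions on open subsets of Euclidean space\<close>

definition partial_deriv :: "'m::finite \<Rightarrow> (real^'m \<Rightarrow> 'b::real_normed_vector) \<Rightarrow> real^'m \<Rightarrow> 'b"
  where "partial_deriv i f x = frechet_derivative f (at x) (axis i 1)"

text \<open>\<open>Ck_on k S f\<close> is only meant for open \<open>S\<close>.\<close>

primrec Ck_on :: "nat \<Rightarrow> (real^'m::finite) set \<Rightarrow> (real^'m \<Rightarrow> 'b::real_normed_vector) \<Rightarrow> bool"
  where
    "Ck_on 0 S f \<longleftrightarrow> continuous_on S f"
  | "Ck_on (Suc k) S f \<longleftrightarrow>
       (\<forall>x\<in>S. f differentiable (at x)) \<and> (\<forall>i. Ck_on k S (partial_deriv i f))"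

definition smooth_on :: "(real^'m::finite) set \<Rightarrow> (real^'m \<Rightarrow> 'b::real_normed_vector) \<Rightarrow> bool"
  where "smooth_on S f \<longleftrightarrow> (\<forall>k. Ck_on k S f)"


section \<open>Smooth manifolds\<close>

text \<open>A chart is a pair of a domain and a coordinate map; the value of the coordinate map
  outside the domain is irrelevant. Charts have open image in \<open>real^'m\<close>, so manifolds have
  dimension \<open>CARD('m)\<close> and no boundary.\<close>

type_synonym ('p, 'm) chart = "'p set \<times> ('p \<Rightarrow> (real, 'm) vec)"

definition chart_dom :: "('p, 'm::finite) chart \<Rightarrow> 'p set"
  where "chart_dom c = fst c"

definition chart_map :: "('p, 'm::finite) chart \<Rightarrow> 'p \<Rightarrow> real^'m"
  where "chart_map c = snd c"

definition chart_inv :: "('p, 'm::finite) chart \<Rightarrow> real^'m \<Rightarrow> 'p"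
  where "chart_inv c = inv_into (chart_dom c) (chart_map c)"

definition is_chart :: "'p topology \<Rightarrow> ('p, 'm::finite) chart \<Rightarrow> bool"
  where "is_chart X c \<longleftrightarrow>
    openin X (chart_dom c) \<and> open (chart_map c ` chart_dom c) \<and>
    homeomorphic_map (subtopology X (chart_dom c))
      (top_of_set (chart_map c ` chart_dom c)) (chart_map c)"

definition transition :: "('p, 'm::finite) chart \<Rightarrow> ('p, 'm) chart \<Rightarrow> real^'m \<Rightarrow> real^'m"
  where "transition c c' = chart_map c' \<circ> chart_inv c"

definition smooth_atlas :: "'p topology \<Rightarrow> ('p, 'm::finite) chart set \<Rightarrow> bool"
  where "smooth_atlas X A \<longleftrightarrow>
    (\<forall>c\<in>A. is_chart X c) \<and> (\<Union>c\<in>A. chart_dom c) = topspace X \<and>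
    (\<forall>c\<in>A. \<forall>c'\<in>A. smooth_on (chart_map c ` (chart_dom c \<inter> chart_dom c')) (transition c c'))"

text \<open>The atlas need not be maximal: it determines the smooth structure, and all notions below
  can be tested on any atlas.\<close>

definition smooth_manifold :: "'p topology \<Rightarrow> ('p, 'm::finite) chart set \<Rightarrow> bool"
  where "smooth_manifold X A \<longleftrightarrow>
    Hausdorff_space X \<and> second_countable X \<and> smooth_atlas X A"

definition oriented_atlas :: "('p, 'm::finite) chart set \<Rightarrow> bool"
  where "oriented_atlas A \<longleftrightarrow>
    (\<forall>c\<in>A. \<forall>c'\<in>A. \<forall>p \<in> chart_dom c \<inter> chart_dom c'.
       det (matrix (frechet_derivative (transition c c') (at (chart_map c p)))) > 0)"

definition orientable :: "'p topology \<Rightarrow> ('p, 'm::finite) chart set \<Rightarrow> bool"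
  where "orientable X A \<longleftrightarrow>
    (\<exists>B. smooth_atlas X B \<and> smooth_atlas X (A \<union> B) \<and> oriented_atlas B)"


section \<open>Riemannian metrics\<close>

definition metric_inner :: "real^'m^'m \<Rightarrow> real^'m \<Rightarrow> real^'m::finite \<Rightarrow> real"
  where "metric_inner G v w = v \<bullet> (G *v w)"

text \<open>A metric tensor is given by its components: \<open>g c p\<close> is the Gram matrix at \<open>p\<close> of the
  coordinate frame of the chart \<open>c\<close>.\<close>

type_synonym ('p, 'm) metric_tensor = "('p, 'm) chart \<Rightarrow> 'p \<Rightarrow> ((real, 'm) vec, 'm) vec"

definition local_metric ::
    "('p, 'm::finite) metric_tensor \<Rightarrow> ('p, 'm) chart \<Rightarrow> real^'m \<Rightarrow> real^'m^'m"
  where "local_metric g c x = g c (chart_inv c x)"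

definition riemannian_metric :: "('p, 'm::finite) chart set \<Rightarrow> ('p, 'm) metric_tensor \<Rightarrow> bool"
  where "riemannian_metric A g \<longleftrightarrow>
    (\<forall>c\<in>A. smooth_on (chart_map c ` chart_dom c) (local_metric g c)) \<and>
    (\<forall>c\<in>A. \<forall>p\<in>chart_dom c.
       transpose (g c p) = g c p \<and> (\<forall>v. v \<noteq> 0 \<longrightarrow> metric_inner (g c p) v v > 0)) \<and>
    (\<forall>c\<in>A. \<forall>c'\<in>A. \<forall>p \<in> chart_dom c \<inter> chart_dom c'.
       let J = frechet_derivative (transition c c') (at (chart_map c p))
       in \<forall>v w. metric_inner (g c' p) (J v) (J w) = metric_inner (g c p) v w)"

definition riemannian_manifold ::
    "'p topology \<Rightarrow> ('p, 'm::finite) chart set \<Rightarrow> ('p, 'm) metric_tensor \<Rightarrow> bool"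
  where "riemannian_manifold X A g \<longleftrightarrow> smooth_manifold X A \<and> riemannian_metric A g"

definition orthonormal_frame :: "real^'m^'m \<Rightarrow> ('m::finite \<Rightarrow> real^'m) \<Rightarrow> bool"
  where "orthonormal_frame G e \<longleftrightarrow>
    (\<forall>i j. metric_inner G (e i) (e j) = (if i = j then 1 else 0))"

text \<open>The trace of a bilinear map. The choice of frame is immaterial, see
  \<open>metric_trace_eq\<close> and \<open>orthonormal_frame_exists\<close> below.\<close>

definition metric_trace ::
    "real^'m^'m \<Rightarrow> (real^'m \<Rightarrow> real^'m \<Rightarrow> 'b::real_vector) \<Rightarrow> 'b"
  where "metric_trace G B =
    (let e = (SOME e. orthonormal_frame G e) in \<Sum>i\<in>(UNIV :: 'm::finite set). B (e i) (e i))"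

text \<open>The Christoffel symbol \<open>\<Gamma>\<^sup>k\<^sub>i\<^sub>j\<close> of the Levi-Civita connection at \<open>p\<close> in the chart \<open>c\<close>.\<close>

definition christoffel ::
    "('p, 'm::finite) metric_tensor \<Rightarrow> ('p, 'm) chart \<Rightarrow> 'p \<Rightarrow> 'm \<Rightarrow> 'm \<Rightarrow> 'm \<Rightarrow> real"
  where "christoffel g c p k i j =
    (let x = chart_map c p; D = (\<lambda>i j l. partial_deriv i (\<lambda>y. local_metric g c y $ j $ l) x)
     in (1/2) * (\<Sum>l\<in>UNIV. matrix_inv (g c p) $ k $ l * (D i j l + D j i l - D l i j)))"

text \<open>The components of the gradient of \<open>f\<close> in the chart \<open>c\<close>.\<close>

definition gradient ::
    "('p, 'm::finite) metric_tensor \<Rightarrow> ('p \<Rightarrow> real) \<Rightarrow> ('p, 'm) chart \<Rightarrow> 'p \<Rightarrow> real^'m"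
  where "gradient g f c p =
    matrix_inv (g c p) *v (\<chi> i. partial_deriv i (f \<circ> chart_inv c) (chart_map c p))"


section \<open>Maps between Riemannian manifolds\<close>

definition local_rep ::
    "('p \<Rightarrow> 'q) \<Rightarrow> ('p, 'm::finite) chart \<Rightarrow> ('q, 'n::finite) chart \<Rightarrow> real^'m \<Rightarrow> real^'n"
  where "local_rep \<psi> c d = chart_map d \<circ> \<psi> \<circ> chart_inv c"

definition smooth_map ::
    "'p topology \<Rightarrow> ('p, 'm::finite) chart set \<Rightarrow> 'q topology \<Rightarrow> ('q, 'n::finite) chart set \<Rightarrow>
     ('p \<Rightarrow> 'q) \<Rightarrow> bool"
  where "smooth_map X A Y B \<psi> \<longleftrightarrow>
    continuous_map X Y \<psi> \<and>
    (\<forall>c\<in>A. \<forall>d\<in>B. smooth_on (chart_map c ` {p \<in> chart_dom c. \<psi> p \<in> chart_dom d}) (local_rep \<psi> c d))"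

text \<open>The differential \<open>d\<psi>\<close> at \<open>p\<close> in the coordinate frames of \<open>c\<close> and \<open>d\<close>.\<close>

definition differential ::
    "('p \<Rightarrow> 'q) \<Rightarrow> ('p, 'm::finite) chart \<Rightarrow> ('q, 'n::finite) chart \<Rightarrow> 'p \<Rightarrow> real^'m \<Rightarrow> real^'n"
  where "differential \<psi> c d p = frechet_derivative (local_rep \<psi> c d) (at (chart_map c p))"

definition nondegenerate ::
    "('p, 'm::finite) chart set \<Rightarrow> ('q, 'n::finite) chart set \<Rightarrow> ('p \<Rightarrow> 'q) \<Rightarrow> bool"
  where "nondegenerate A B \<psi> \<longleftrightarrow>
    (\<forall>c\<in>A. \<forall>d\<in>B. \<forall>p\<in>chart_dom c. \<psi> p \<in> chart_dom d \<longrightarrow> {v. differential \<psi> c d p v = 0} = {0})"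

definition chart_at :: "('p, 'm::finite) chart set \<Rightarrow> 'p \<Rightarrow> ('p, 'm) chart"
  where "chart_at A p = (SOME c. c \<in> A \<and> p \<in> chart_dom c)"

text \<open>\<open>norm_differential_sq A B g h \<psi> p\<close> is \<open>|d\<psi>|\<^sup>2\<close> at \<open>p\<close>; the value does not depend on the charts
  used to compute it.\<close>

definition norm_differential_sq ::
    "('p, 'm::finite) chart set \<Rightarrow> ('q, 'n::finite) chart set \<Rightarrow>
     ('p, 'm) metric_tensor \<Rightarrow> ('q, 'n) metric_tensor \<Rightarrow> ('p \<Rightarrow> 'q) \<Rightarrow> 'p \<Rightarrow> real"
  where "norm_differential_sq A B g h \<psi> p =
    (let c = chart_at A p; d = chart_at B (\<psi> p)
     in metric_trace (g c p)
          (\<lambda>v w. metric_inner (h d (\<psi> p)) (differential \<psi> c d p v) (differential \<psi> c d p w)))"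

text \<open>The second fundamental form \<open>\<nabla>d\<psi>\<close>, from
  \<open>(\<nabla>d\<psi>)(\<partial>\<^sub>i,\<partial>\<^sub>j) = \<nabla>\<^sub>i (d\<psi> \<partial>\<^sub>j) - d\<psi> (\<nabla>\<^sub>i \<partial>\<^sub>j)\<close>, where the first covariant derivative is the one
  of the pull-back bundle.\<close>

definition second_fundamental_form ::
    "('p, 'm::finite) metric_tensor \<Rightarrow> ('q, 'n::finite) metric_tensor \<Rightarrow> ('p \<Rightarrow> 'q) \<Rightarrow>
     ('p, 'm) chart \<Rightarrow> ('q, 'n) chart \<Rightarrow> 'p \<Rightarrow> real^'m \<Rightarrow> real^'m \<Rightarrow> real^'n"
  where "second_fundamental_form g h \<psi> c d p v w =
    (let x = chart_map c p; F = local_rep \<psi> c d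
     in \<Sum>i\<in>UNIV. \<Sum>j\<in>UNIV. (v $ i * w $ j) *\<^sub>R
          (partial_deriv i (partial_deriv j F) x
           + (\<chi> r. \<Sum>s\<in>UNIV. \<Sum>t\<in>UNIV.
                christoffel h d (\<psi> p) r s t * partial_deriv i F x $ s * partial_deriv j F x $ t)
           - (\<Sum>k\<in>UNIV. christoffel g c p k i j *\<^sub>R partial_deriv k F x)))"

definition tension_field ::
    "('p, 'm::finite) metric_tensor \<Rightarrow> ('q, 'n::finite) metric_tensor \<Rightarrow> ('p \<Rightarrow> 'q) \<Rightarrow>
     ('p, 'm) chart \<Rightarrow> ('q, 'n) chart \<Rightarrow> 'p \<Rightarrow> real^'n"
  where "tension_field g h \<psi> c d p = metric_trace (g c p) (second_fundamental_form g h \<psi> c d p)"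

definition harmonic ::
    "('p, 'm::finite) chart set \<Rightarrow> ('q, 'n::finite) chart set \<Rightarrow>
     ('p, 'm) metric_tensor \<Rightarrow> ('q, 'n) metric_tensor \<Rightarrow> ('p \<Rightarrow> 'q) \<Rightarrow> bool"
  where "harmonic A B g h \<psi> \<longleftrightarrow>
    (\<forall>c\<in>A. \<forall>d\<in>B. \<forall>p\<in>chart_dom c. \<psi> p \<in> chart_dom d \<longrightarrow> tension_field g h \<psi> c d p = 0)"

definition alpha_weight ::
    "real \<Rightarrow> ('p, 'm::finite) chart set \<Rightarrow> ('q, 'n::finite) chart set \<Rightarrow>
     ('p, 'm) metric_tensor \<Rightarrow> ('q, 'n) metric_tensor \<Rightarrow> ('p \<Rightarrow> 'q) \<Rightarrow> 'p \<Rightarrow> real"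
  where "alpha_weight \<alpha> A B g h \<psi> p =
    2 * \<alpha> * (1 + norm_differential_sq A B g h \<psi> p) powr (\<alpha> - 1)"

definition alpha_tension_field ::
    "real \<Rightarrow> ('p, 'm::finite) chart set \<Rightarrow> ('q, 'n::finite) chart set \<Rightarrow>
     ('p, 'm) metric_tensor \<Rightarrow> ('q, 'n) metric_tensor \<Rightarrow> ('p \<Rightarrow> 'q) \<Rightarrow>
     ('p, 'm) chart \<Rightarrow> ('q, 'n) chart \<Rightarrow> 'p \<Rightarrow> real^'n"
  where "alpha_tension_field \<alpha> A B g h \<psi> c d p =
    alpha_weight \<alpha> A B g h \<psi> p *\<^sub>R tension_field g h \<psi> c d p
    + differential \<psi> c d p (gradient g (alpha_weight \<alpha> A B g h \<psi>) c p)"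

text \<open>\<open>alpha_tension_field = 0\<close> is the Euler-Lagrange equation of the \<open>\<alpha>\<close>-energy
  \<open>\<integral> (1 + |d\<psi>|\<^sup>2)\<^sup>\<alpha> dV\<close>, just as \<open>tension_field = 0\<close> is that of the Dirichlet energy.\<close>

definition alpha_harmonic ::
    "real \<Rightarrow> ('p, 'm::finite) chart set \<Rightarrow> ('q, 'n::finite) chart set \<Rightarrow>
     ('p, 'm) metric_tensor \<Rightarrow> ('q, 'n) metric_tensor \<Rightarrow> ('p \<Rightarrow> 'q) \<Rightarrow> bool"
  where "alpha_harmonic \<alpha> A B g h \<psi> \<longleftrightarrow>
    (\<forall>c\<in>A. \<forall>d\<in>B. \<forall>p\<in>chart_dom c. \<psi> p \<in> chart_dom d \<longrightarrow>
       alpha_tension_field \<alpha> A B g h \<psi> c d p = 0)"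

definition conformal_metric ::
    "('p \<Rightarrow> real) \<Rightarrow> ('p, 'm::finite) metric_tensor \<Rightarrow> ('p, 'm) metric_tensor"
  where "conformal_metric \<rho> g = (\<lambda>c p. \<rho> p *\<^sub>R g c p)"


section \<open>The metric trace is well defined\<close>

lemma metric_inner_add_left: "metric_inner G (u + v) w = metric_inner G u w + metric_inner G v w"
  by (simp add: metric_inner_def inner_add_left)

lemma metric_inner_scaleR_left: "metric_inner G (r *\<^sub>R v) w = r * metric_inner G v w"
  by (simp add: metric_inner_def)

lemma metric_inner_scaleR_right: "metric_inner G v (r *\<^sub>R w) = r * metric_inner G v w"
  by (simp add: metric_inner_def matrix_vector_mult_scaleR)

lemma metric_inner_diff_left: "metric_inner G (u - v) w = metric_inner G u w - metric_inner G v w"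
  by (simp add: metric_inner_def inner_diff_left)

lemma metric_inner_sum_left: "metric_inner G (sum f S) w = (\<Sum>i\<in>S. metric_inner G (f i) w)"
  by (simp add: metric_inner_def inner_sum_left)

lemma metric_inner_commute:
  assumes "transpose G = G"
  shows "metric_inner G v w = metric_inner G w v"
  unfolding metric_inner_def by (metis assms dot_lmul_matrix inner_commute vector_transpose_matrix)

lemma orthonormal_frame_exists:
  fixes G :: "real^'m::finite^'m"
  assumes sym: "transpose G = G" and pos: "\<And>v. v \<noteq> 0 \<Longrightarrow> metric_inner G v v > 0"
  shows "\<exists>e. orthonormal_frame G e"
proof -
  have *: "\<exists>S :: (real^'m) set. finite S \<and> card S = k \<and>
      (\<forall>s\<in>S. \<forall>t\<in>S. metric_inner G s t = (if s = t then 1 else 0))" if "k \<le> CARD('m)" for k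
    using that
  proof (induction k)
    case 0
    show ?case by (rule exI[of _ "{}"]) simp
  next
    case (Suc k)
    then obtain S :: "(real^'m) set" where S: "finite S" "card S = k"
      "\<And>s t. s \<in> S \<Longrightarrow> t \<in> S \<Longrightarrow> metric_inner G s t = (if s = t then 1 else 0)"
      by force
    have "dim (span S) < DIM(real^'m)"
      using Suc.prems S dim_le_card'[OF S(1)] by simp
    then have "span S \<noteq> UNIV" by (metis dim_UNIV less_irrefl)
    then obtain v where v: "v \<notin> span S" by blast
    define w where "w = v - (\<Sum>s\<in>S. metric_inner G v s *\<^sub>R s)"
    have "(\<Sum>s\<in>S. metric_inner G v s *\<^sub>R s) \<in> span S"
      by (intro span_sum span_scale span_base)
    then have "w \<noteq> 0" using v by (auto simp: w_def)
    then have wpos: "metric_inner G w w > 0" by (rule pos)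
    have w0: "metric_inner G w t = 0" if "t \<in> S" for t
    proof -
      have "(\<Sum>s\<in>S. metric_inner G v s * metric_inner G s t)
          = (\<Sum>s\<in>S. if s = t then metric_inner G v s else 0)"
        by (rule sum.cong) (auto simp: S(3) that)
      also have "\<dots> = metric_inner G v t" using S(1) that by simp
      finally show ?thesis
        by (simp add: w_def metric_inner_diff_left metric_inner_sum_left metric_inner_scaleR_left)
    qed
    define u where "u = (1 / sqrt (metric_inner G w w)) *\<^sub>R w"
    have u0: "metric_inner G u t = 0" "metric_inner G t u = 0" if "t \<in> S" for t
      using w0[OF that] metric_inner_commute[OF sym, of t u]
      by (simp_all add: u_def metric_inner_scaleR_left)
    have u1: "metric_inner G u u = 1"
      using wpos
      by (simp add: u_def metric_inner_scaleR_left metric_inner_scaleR_right)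
    have "u \<notin> S" using u0 u1 by fastforce
    then show ?case
      using S u0 u1 by (intro exI[of _ "insert u S"]) auto
  qed
  obtain S :: "(real^'m) set" where S: "finite S" "card S = CARD('m)"
    "\<And>s t. s \<in> S \<Longrightarrow> t \<in> S \<Longrightarrow> metric_inner G s t = (if s = t then 1 else 0)"
    using *[OF order_refl] by blast
  then obtain e where e: "bij_betw e (UNIV :: 'm set) S"
    using finite_same_card_bij[of "UNIV :: 'm set" S] by auto
  have "orthonormal_frame G e"
    unfolding orthonormal_frame_def
    using S(3) e by (auto simp: bij_betw_def inj_on_def)
  then show ?thesis by blast
qed

lemma orthonormal_frame_sum:
  fixes G :: "real^'m::finite^'m" and B :: "real^'m \<Rightarrow> real^'m \<Rightarrow> 'b::real_vector"
  assumes e: "orthonormal_frame G e"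
    and B1: "\<And>w. linear (\<lambda>v. B v w)" and B2: "\<And>v. linear (B v)"
  shows "(\<Sum>i\<in>UNIV. B (e i) (e i))
       = (\<Sum>k\<in>UNIV. \<Sum>l\<in>UNIV. matrix_inv G $ k $ l *\<^sub>R B (axis k 1) (axis l 1))"
proof -
  define E :: "real^'m^'m" where "E = (\<chi> k i. e i $ k)"
  have ET: "(transpose E ** (G ** E)) $ i $ j = metric_inner G (e i) (e j)" for i j
    by (simp add: metric_inner_def E_def transpose_def matrix_matrix_mult_def
        matrix_vector_mult_def inner_vec_def)
  have one: "transpose E ** (G ** E) = mat 1"
    using e by (simp add: vec_eq_iff ET orthonormal_frame_def mat_def)
  then have "(G ** E) ** transpose E = mat 1"
    by (rule iffD1[OF matrix_left_right_inverse])
  then have GE: "G ** (E ** transpose E) = mat 1"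
    by (simp add: matrix_mul_assoc)
  then have EG: "(E ** transpose E) ** G = mat 1"
    by (rule iffD1[OF matrix_left_right_inverse])
  have "G ** matrix_inv G = mat 1 \<and> matrix_inv G ** G = mat 1"
    unfolding matrix_inv_def by (rule someI[of _ "E ** transpose E"]) (use GE EG in blast)
  then have inv: "matrix_inv G = E ** transpose E"
    by (metis EG matrix_mul_assoc matrix_mul_lid matrix_mul_rid)
  have ax: "e i = (\<Sum>k\<in>UNIV. (e i $ k) *\<^sub>R axis k 1)" for i
    using basis_expansion[of "e i"] by (simp add: scalar_mult_eq_scaleR)
  have Bi: "B (e i) (e i)
      = (\<Sum>k\<in>UNIV. \<Sum>l\<in>UNIV. (e i $ k * e i $ l) *\<^sub>R B (axis k 1) (axis l 1))" for i
  proof -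
    have "B (e i) (e i) = (\<Sum>k\<in>UNIV. (e i $ k) *\<^sub>R B (axis k 1) (e i))"
      by (subst (1) ax) (simp add: linear_sum[OF B1] linear_cmul[OF B1])
    also have "\<dots> = (\<Sum>k\<in>UNIV. (e i $ k) *\<^sub>R (\<Sum>l\<in>UNIV. (e i $ l) *\<^sub>R B (axis k 1) (axis l 1)))"
      by (subst (2) ax) (simp add: linear_sum[OF B2] linear_cmul[OF B2])
    finally show ?thesis by (simp add: scaleR_sum_right)
  qed
  have "(\<Sum>i\<in>UNIV. B (e i) (e i))
      = (\<Sum>k\<in>UNIV. \<Sum>l\<in>UNIV. \<Sum>i\<in>UNIV. (e i $ k * e i $ l) *\<^sub>R B (axis k 1) (axis l 1))"
    unfolding Bi by (subst sum.swap, rule sum.cong[OF refl], rule sum.swap)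
  then show ?thesis
    by (simp add: inv E_def transpose_def matrix_matrix_mult_def scaleR_sum_left)
qed

lemma metric_trace_eq:
  fixes G :: "real^'m::finite^'m"
  assumes "orthonormal_frame G e" "\<And>w. linear (\<lambda>v. B v w)" "\<And>v. linear (B v)"
  shows "metric_trace G B = (\<Sum>i\<in>UNIV. B (e i) (e i))"
proof -
  have "orthonormal_frame G (SOME e. orthonormal_frame G e)"
    using assms(1) by (rule someI[of "orthonormal_frame G"])
  from orthonormal_frame_sum[OF this assms(2,3)] orthonormal_frame_sum[OF assms]
  show ?thesis by (simp add: metric_trace_def Let_def)
qed

end

theory Submission
  imports Defs
begin

text \<open>Write \<open>w = 2\<alpha>(1 + |d\<psi>|\<^sup>2)^(\<alpha>-1)\<close>; the conformal factor is \<open>\<rho> = w^(2/(m-2))\<close>. Under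
  \<open>g \<mapsto> \<rho> g\<close> only the trace of the Christoffel symbols of the domain changes, and one gets
  \<open>\<rho> \<tau>' = \<tau> + (m-2)/(2\<rho>) d\<psi>(grad \<rho>) = \<tau> + d\<psi>(grad w)/w\<close>, so \<open>\<rho> w \<tau>'\<close> is the \<open>\<alpha>\<close>-tension field.
  The analytic point is that \<open>|d\<psi>|\<^sup>2\<close>, computed at each point in an arbitrarily chosen chart, is
  differentiable; this follows from its chart independence and its formula in fixed coordinates.\<close>

section \<open>Differentiability\<close>

lemma partial_deriv_eq:
  "(f has_derivative D) (at x) \<Longrightarrow> partial_deriv i f x = D (axis i 1)"
  by (metis frechet_derivative_at partial_deriv_def)

lemma smooth_on_differentiable:
  assumes "smooth_on S f" "x \<in> S"
  shows "f differentiable at x"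
proof -
  have "Ck_on (Suc 0) S f" using assms(1) unfolding smooth_on_def by blast
  then show ?thesis using assms(2) by simp
qed

lemma smooth_on_partial_deriv:
  assumes "smooth_on S f"
  shows "smooth_on S (partial_deriv i f)"
  unfolding smooth_on_def
proof
  fix k
  have "Ck_on (Suc k) S f" using assms unfolding smooth_on_def by blast
  then show "Ck_on k S (partial_deriv i f)" by simp
qed

lemma differentiable_vec_nth:
  "f differentiable F \<Longrightarrow> (\<lambda>x. f x $ i) differentiable F"
  unfolding differentiable_def
  by (blast intro: bounded_linear.has_derivative[OF bounded_linear_vec_nth])

lemma differentiable_prod:
  fixes f :: "'i \<Rightarrow> 'a::real_normed_vector \<Rightarrow> 'b::real_normed_field"
  assumes "\<And>i. i \<in> I \<Longrightarrow> f i differentiable (at x within S)"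
  shows "(\<lambda>x. \<Prod>i\<in>I. f i x) differentiable (at x within S)"
proof -
  obtain f' where "\<And>i. i \<in> I \<Longrightarrow> (f i has_derivative f' i) (at x within S)"
    using assms unfolding differentiable_def by metis
  from has_derivative_prod[of I f f', OF this] show ?thesis
    unfolding differentiable_def by blast
qed

text \<open>The Leibniz expansion is a finite sum of products of entries, so differentiability of
  the entries suffices.\<close>

lemma differentiable_det:
  fixes M :: "'a::real_normed_vector \<Rightarrow> real^'n::finite^'n"
  assumes "\<And>i j. (\<lambda>x. M x $ i $ j) differentiable (at x within S)"
  shows "(\<lambda>x. det (M x)) differentiable (at x within S)"
  unfolding det_def
  by (intro differentiable_sum ballI differentiable_mult differentiable_const differentiable_prod assms)
    (simp add: finite_permutations)

section \<open>Positive definite matrices\<close>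

lemma matrix_inv_right:
  fixes G :: "real^'n::finite^'n"
  assumes "invertible G"
  shows "G ** matrix_inv G = mat 1"
  using assms unfolding invertible_def matrix_inv_def by (metis (mono_tags, lifting) someI_ex)

lemma matrix_inv_left:
  fixes G :: "real^'n::finite^'n"
  assumes "invertible G"
  shows "matrix_inv G ** G = mat 1"
  using assms unfolding invertible_def matrix_inv_def by (metis (mono_tags, lifting) someI_ex)

text \<open>For square matrices a one-sided inverse is two-sided. This identifies the value that the
  choice operator in \<open>matrix_inv\<close> returns.\<close>

lemma matrix_inv_unique:
  fixes G :: "real^'n::finite^'n"
  assumes "G ** H = mat 1"
  shows "matrix_inv G = H"
proof -
  have "invertible G" using assms matrix_left_right_inverse unfolding invertible_def by blast
  from matrix_inv_left[OF this] show ?thesis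
    by (metis assms matrix_mul_assoc matrix_mul_lid matrix_mul_rid)
qed

lemma matrix_inv_scaleR:
  fixes G :: "real^'n::finite^'n"
  assumes "invertible G" "r \<noteq> 0"
  shows "matrix_inv (r *\<^sub>R G) = (1 / r) *\<^sub>R matrix_inv G"
  by (rule matrix_inv_unique)
    (simp add: assms matrix_inv_right scalar_matrix_assoc[symmetric] matrix_scalar_ac)

text \<open>A vector in the kernel has length zero, hence vanishes; a square matrix with trivial
  kernel is invertible.\<close>

lemma positive_definite_invertible:
  fixes G :: "real^'n::finite^'n"
  assumes "\<And>v. v \<noteq> 0 \<Longrightarrow> metric_inner G v v > 0"
  shows "invertible G"
proof -
  have "v = 0" if "G *v v = 0" for v
    using assms[of v] that by (force simp: metric_inner_def)
  then show ?thesis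
    unfolding invertible_left_inverse matrix_left_invertible_ker by blast
qed

text \<open>Column \<open>l\<close> of the inverse solves \<open>G *v x = axis l 1\<close>, so
  Cramer's rule applies. The entries become quotients of determinants, which can be
  differentiated.\<close>

lemma matrix_inv_cramer:
  fixes G :: "real^'n::finite^'n"
  assumes "invertible G"
  shows "matrix_inv G $ k $ l = det (\<chi> i j. if j = k then axis l 1 $ i else G $ i $ j) / det G"
proof -
  have "G *v (matrix_inv G *v axis l 1) = axis l 1"
    by (simp add: matrix_vector_mul_assoc matrix_inv_right[OF assms])
  then have "matrix_inv G *v axis l 1
      = (\<chi> k. det (\<chi> i j. if j = k then axis l 1 $ i else G $ i $ j) / det G)"
    using cramer[of G "matrix_inv G *v axis l 1" "axis l 1"] assms invertible_det_nz by blast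
  moreover have "(matrix_inv G *v axis l 1) $ k = matrix_inv G $ k $ l"
    by (simp add: matrix_vector_mul_component inner_axis)
  ultimately show ?thesis by simp
qed

lemma differentiable_matrix_inv:
  fixes M :: "'a::real_normed_vector \<Rightarrow> real^'n::finite^'n"
  assumes "M differentiable at x" "open S" "x \<in> S" "\<And>y. y \<in> S \<Longrightarrow> invertible (M y)"
  shows "(\<lambda>y. matrix_inv (M y) $ k $ l) differentiable at x"
proof -
  have M: "(\<lambda>y. M y $ i $ j) differentiable at x" for i j
    by (intro differentiable_vec_nth assms(1))
  have "(\<lambda>y. det (\<chi> i j. if j = k then axis l 1 $ i else M y $ i $ j) / det (M y))
      differentiable at x"
  proof (intro differentiable_divide differentiable_det M)
    show "(\<lambda>y. (\<chi> i j. if j = k then axis l 1 $ i else M y $ i $ j) $ i $ j) differentiable at x"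
      for i j by (cases "j = k") (simp_all add: M)
    show "det (M x) \<noteq> 0" using assms(3,4) invertible_det_nz by blast
  qed
  then obtain D where
    D: "((\<lambda>y. det (\<chi> i j. if j = k then axis l 1 $ i else M y $ i $ j) / det (M y))
        has_derivative D) (at x)"
    unfolding differentiable_def by blast
  \<comment> \<open>Cramer's formula equals the inverse only where the matrix is invertible; this
    holds on the open set \<open>S\<close> around \<open>x\<close>, which is enough to transfer the
    derivative.\<close>
  show ?thesis
    by (rule differentiableI, rule has_derivative_transform_within_open[OF D assms(2,3)])
      (simp add: matrix_inv_cramer assms(4))
qed

section \<open>Charts\<close>

text \<open>A chart map is a homeomorphism onto an open set: it is injective, so
  \<open>inv_into\<close> really inverts it on the domain, and images of open subsets are open in
  the full Euclidean space, not only relative to the image.\<close>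

lemma
  assumes "is_chart X c"
  shows is_chart_openin: "openin X (chart_dom c)"
    and chart_inv_chart_map: "p \<in> chart_dom c \<Longrightarrow> chart_inv c (chart_map c p) = p"
    and is_chart_open_image: "\<lbrakk>openin X S; S \<subseteq> chart_dom c\<rbrakk> \<Longrightarrow> open (chart_map c ` S)"
proof -
  let ?T = "subtopology X (chart_dom c)"
  have hom: "homeomorphic_map ?T (top_of_set (chart_map c ` chart_dom c)) (chart_map c)"
    and opn: "open (chart_map c ` chart_dom c)"
    and dom: "openin X (chart_dom c)"
    using assms unfolding is_chart_def by auto
  show "openin X (chart_dom c)" by (fact dom)
  have "topspace ?T = chart_dom c"
    using openin_subset[OF dom] by auto
  then have inj: "inj_on (chart_map c) (chart_dom c)"
    using hom unfolding homeomorphic_eq_everything_map by simp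
  show "p \<in> chart_dom c \<Longrightarrow> chart_inv c (chart_map c p) = p"
    unfolding chart_inv_def by (rule inv_into_f_f[OF inj])
  show "open (chart_map c ` S)" if S: "openin X S" "S \<subseteq> chart_dom c"
  proof -
    have "openin ?T S" using S by (metis inf.absorb_iff2 inf_commute openin_subtopology)
    then have "openin (top_of_set (chart_map c ` chart_dom c)) (chart_map c ` S)"
      using homeomorphic_imp_open_map[OF hom] unfolding open_map_def by blast
    then show ?thesis using opn openin_open_trans by blast
  qed
qed

lemma smooth_atlas_chart:
  "smooth_atlas X A \<Longrightarrow> c \<in> A \<Longrightarrow> is_chart X c"
  by (simp add: smooth_atlas_def)

lemma chart_at_mem:
  assumes "smooth_atlas X A" "p \<in> topspace X"
  shows "chart_at A p \<in> A" "p \<in> chart_dom (chart_at A p)"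
proof -
  have "\<exists>c. c \<in> A \<and> p \<in> chart_dom c"
    using assms unfolding smooth_atlas_def by blast
  from someI_ex[OF this] show "chart_at A p \<in> A" "p \<in> chart_dom (chart_at A p)"
    unfolding chart_at_def by auto
qed

lemma transition_differentiable:
  assumes "smooth_atlas X A" "c \<in> A" "c' \<in> A" "p \<in> chart_dom c" "p \<in> chart_dom c'"
  shows "transition c c' differentiable at (chart_map c p)"
proof (rule smooth_on_differentiable)
  show "smooth_on (chart_map c ` (chart_dom c \<inter> chart_dom c')) (transition c c')"
    using assms unfolding smooth_atlas_def by blast
qed (use assms in auto)

section \<open>The squared norm of the differential\<close>

lemma smooth_atlas_of_riemannian: "riemannian_manifold X A g \<Longrightarrow> smooth_atlas X A"
  by (simp add: riemannian_manifold_def smooth_manifold_def)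

lemma riemannian_manifold_metric:
  assumes "riemannian_manifold X A g" "c \<in> A"
  shows "smooth_on (chart_map c ` chart_dom c) (local_metric g c)"
    and "p \<in> chart_dom c \<Longrightarrow> transpose (g c p) = g c p"
    and "p \<in> chart_dom c \<Longrightarrow> v \<noteq> 0 \<Longrightarrow> metric_inner (g c p) v v > 0"
  using assms unfolding riemannian_manifold_def riemannian_metric_def by auto

lemma riemannian_manifold_metric_transition:
  assumes "riemannian_manifold X A g" "c \<in> A" "c' \<in> A" "p \<in> chart_dom c" "p \<in> chart_dom c'"
  defines "J \<equiv> frechet_derivative (transition c c') (at (chart_map c p))"
  shows "metric_inner (g c' p) (J v) (J w) = metric_inner (g c p) v w"
  using assms unfolding riemannian_manifold_def riemannian_metric_def Let_def by blast

lemma riemannian_orthonormal_frame: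
  assumes "riemannian_manifold X A g" "c \<in> A" "p \<in> chart_dom c"
  obtains e where "orthonormal_frame (g c p) e"
  using orthonormal_frame_exists riemannian_manifold_metric(2,3)[OF assms(1,2)] assms(3) by metis

lemma riemannian_invertible:
  assumes "riemannian_manifold X A g" "c \<in> A" "p \<in> chart_dom c"
  shows "invertible (g c p)"
  using riemannian_manifold_metric(3)[OF assms] by (rule positive_definite_invertible)

lemma linear_metric_inner_left: "linear (\<lambda>v. metric_inner G v w)"
  by (rule linearI) (simp_all add: metric_inner_add_left metric_inner_scaleR_left)

lemma linear_metric_inner_right: "linear (metric_inner G v)"
  by (rule linearI)
    (simp_all add: metric_inner_def matrix_vector_right_distrib inner_add_right
      matrix_vector_mult_scaleR)

lemma smooth_map_openin_preimage:
  assumes "smooth_map X A Y B \<psi>" "openin X S" "openin Y T"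
  shows "openin X {q \<in> S. \<psi> q \<in> T}"
proof -
  have "openin X {q \<in> topspace X. \<psi> q \<in> T}"
    using assms unfolding smooth_map_def by (blast intro: openin_continuous_map_preimage)
  moreover have "{q \<in> S. \<psi> q \<in> T} = S \<inter> {q \<in> topspace X. \<psi> q \<in> T}"
    using openin_subset[OF assms(2)] by blast
  ultimately show ?thesis using assms(2) by (simp add: openin_Int)
qed

lemma smooth_map_topspace:
  "smooth_map X A Y B \<psi> \<Longrightarrow> p \<in> topspace X \<Longrightarrow> \<psi> p \<in> topspace Y"
  unfolding smooth_map_def continuous_map_def by blast

section \<open>Chart independence and differentiability of |d\<psi>|^2\<close>

context
  fixes X :: "'p topology" and A :: "('p, 'm::finite) chart set" and g :: "('p, 'm) metric_tensor"
    and Y :: "'q topology" and B :: "('q, 'n::finite) chart set" and h :: "('q, 'n) metric_tensor"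
    and \<psi> :: "'p \<Rightarrow> 'q"
  assumes M: "riemannian_manifold X A g"
    and N: "riemannian_manifold Y B h"
    and smooth: "smooth_map X A Y B \<psi>"
begin

lemma chart_of_domain: "c \<in> A \<Longrightarrow> is_chart X c"
  using smooth_atlas_chart[OF smooth_atlas_of_riemannian[OF M]] .

lemma chart_of_codomain: "d \<in> B \<Longrightarrow> is_chart Y d"
  using smooth_atlas_chart[OF smooth_atlas_of_riemannian[OF N]] .

lemma smooth_on_local_rep:
  assumes "c \<in> A" "d \<in> B"
  shows "smooth_on (chart_map c ` {p \<in> chart_dom c. \<psi> p \<in> chart_dom d}) (local_rep \<psi> c d)"
  using smooth assms unfolding smooth_map_def by blast

lemma local_rep_differentiable:
  assumes "c \<in> A" "d \<in> B" "p \<in> chart_dom c" "\<psi> p \<in> chart_dom d"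
  shows "local_rep \<psi> c d differentiable at (chart_map c p)"
  using smooth_on_differentiable[OF smooth_on_local_rep] assms by blast

lemma linear_differential:
  assumes "c \<in> A" "d \<in> B" "p \<in> chart_dom c" "\<psi> p \<in> chart_dom d"
  shows "linear (differential \<psi> c d p)"
  unfolding differential_def using local_rep_differentiable[OF assms]
  by (rule linear_frechet_derivative)

lemma open_local_rep_domain:
  assumes "c \<in> A" "openin X S" "S \<subseteq> chart_dom c" "openin Y T"
  shows "open (chart_map c ` {p \<in> S. \<psi> p \<in> T})"
  by (rule is_chart_open_image[OF chart_of_domain[OF assms(1)]
        smooth_map_openin_preimage[OF smooth assms(2,4)]])
    (use assms(3) in blast)

text \<open>Near the point, following a change of charts in the domain by the new representation of
  \<psi> is the same as following the old representation by a change of charts in the codomain. The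
  chain rule on both sides gives the claim.\<close>

lemma differential_transition:
  assumes "c \<in> A" "c' \<in> A" "d \<in> B" "d' \<in> B"
    and "p \<in> chart_dom c" "p \<in> chart_dom c'" "\<psi> p \<in> chart_dom d" "\<psi> p \<in> chart_dom d'"
  shows "differential \<psi> c' d' p (frechet_derivative (transition c c') (at (chart_map c p)) v)
    = frechet_derivative (transition d d') (at (chart_map d (\<psi> p))) (differential \<psi> c d p v)"
proof -
  let ?x = "chart_map c p"
  \<comment> \<open>All four charts are usable on this set, so the two composites agree there; being
    open, it passes the equality on to derivatives at \<open>?x\<close>.\<close>
  let ?U = "chart_map c ` {q \<in> chart_dom c \<inter> chart_dom c'. \<psi> q \<in> chart_dom d \<inter> chart_dom d'}"
  have inv: "chart_inv c (chart_map c q) = q" if "q \<in> chart_dom c" for q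
    using chart_inv_chart_map[OF chart_of_domain] assms(1) that by blast
  have inv': "chart_inv c' (chart_map c' q) = q" if "q \<in> chart_dom c'" for q
    using chart_inv_chart_map[OF chart_of_domain] assms(2) that by blast
  have invd: "chart_inv d (chart_map d q) = q" if "q \<in> chart_dom d" for q
    using chart_inv_chart_map[OF chart_of_codomain] assms(3) that by blast
  have tx: "transition c c' ?x = chart_map c' p" and fx: "local_rep \<psi> c d ?x = chart_map d (\<psi> p)"
    using assms by (simp_all add: transition_def local_rep_def inv)
  have op: "open ?U"
    using assms(1-4) by (intro open_local_rep_domain openin_Int is_chart_openin
        chart_of_domain chart_of_codomain) auto
  have t: "transition c c' differentiable at ?x"
    using transition_differentiable[OF smooth_atlas_of_riemannian[OF M]] assms by blast
  have f': "local_rep \<psi> c' d' differentiable at (transition c c' ?x)"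
    unfolding tx by (rule local_rep_differentiable) (use assms in auto)
  have f: "local_rep \<psi> c d differentiable at ?x"
    by (rule local_rep_differentiable) (use assms in auto)
  have t': "transition d d' differentiable at (local_rep \<psi> c d ?x)"
    unfolding fx using transition_differentiable[OF smooth_atlas_of_riemannian[OF N]] assms by blast
  have "frechet_derivative (local_rep \<psi> c' d' \<circ> transition c c') (at ?x)
      = frechet_derivative (transition d d' \<circ> local_rep \<psi> c d) (at ?x)"
  proof (rule frechet_derivative_transform_within_open[OF _ op])
    show "local_rep \<psi> c' d' \<circ> transition c c' differentiable at ?x"
      by (rule differentiable_chain_at[OF t f'])
    show "?x \<in> ?U" using assms by blast
    show "(local_rep \<psi> c' d' \<circ> transition c c') y = (transition d d' \<circ> local_rep \<psi> c d) y"
      if "y \<in> ?U" for y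
      using that by (auto simp: local_rep_def transition_def inv inv' invd)
  qed
  then show ?thesis
    unfolding frechet_derivative_compose[OF t f'] frechet_derivative_compose[OF f t'] tx fx
    by (simp add: differential_def o_def fun_eq_iff)
qed

text \<open>Unlike in \<open>norm_differential_sq\<close>, the charts are parameters, so that two
  choices can be compared and one choice kept fixed near a point.\<close>

definition local_norm_sq :: "('p, 'm) chart \<Rightarrow> ('q, 'n) chart \<Rightarrow> 'p \<Rightarrow> real"
  where "local_norm_sq c d p = metric_trace (g c p)
    (\<lambda>v w. metric_inner (h d (\<psi> p)) (differential \<psi> c d p v) (differential \<psi> c d p w))"

text \<open>Supplies the bilinearity under which the trace may be taken in any orthonormal frame or
  in coordinates.\<close>

lemma bilinear_pullback:
  assumes "c \<in> A" "d \<in> B" "p \<in> chart_dom c" "\<psi> p \<in> chart_dom d"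
  shows "linear (\<lambda>v. metric_inner H (differential \<psi> c d p v) (differential \<psi> c d p w))"
    and "linear (\<lambda>w. metric_inner H (differential \<psi> c d p v) (differential \<psi> c d p w))"
  using linear_compose[OF linear_differential[OF assms] linear_metric_inner_left]
    linear_compose[OF linear_differential[OF assms] linear_metric_inner_right]
  by (simp_all add: o_def)

text \<open>The domain transition carries an orthonormal frame in \<open>c\<close> to one in
  \<open>c'\<close>, and the codomain transition preserves \<open>h\<close>. The two traces in these
  frames therefore agree term by term.\<close>

lemma local_norm_sq_transition:
  assumes "c \<in> A" "c' \<in> A" "d \<in> B" "d' \<in> B"
    and "p \<in> chart_dom c" "p \<in> chart_dom c'" "\<psi> p \<in> chart_dom d" "\<psi> p \<in> chart_dom d'"
  shows "local_norm_sq c' d' p = local_norm_sq c d p"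
proof -
  obtain e where e: "orthonormal_frame (g c p) e"
    using riemannian_orthonormal_frame[OF M] assms by blast
  let ?J = "frechet_derivative (transition c c') (at (chart_map c p))"
  have e': "orthonormal_frame (g c' p) (\<lambda>i. ?J (e i))"
    using e riemannian_manifold_metric_transition[OF M] assms unfolding orthonormal_frame_def
    by simp
  show ?thesis
    unfolding local_norm_sq_def
      metric_trace_eq[OF e bilinear_pullback[OF assms(1,3,5,7)]]
      metric_trace_eq[OF e' bilinear_pullback[OF assms(2,4,6,8)]]
      differential_transition[OF assms]
    using riemannian_manifold_metric_transition[OF N] assms by simp
qed

text \<open>The charts picked by \<open>chart_at\<close> may jump from point to point; this replaces
  them by fixed ones, as differentiation requires.\<close>

lemma norm_differential_sq_eq:
  assumes "c \<in> A" "d \<in> B" "p \<in> chart_dom c" "\<psi> p \<in> chart_dom d"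
  shows "norm_differential_sq A B g h \<psi> p = local_norm_sq c d p"
proof -
  have p: "p \<in> topspace X"
    using openin_subset[OF is_chart_openin[OF chart_of_domain]] assms by blast
  note A = chart_at_mem[OF smooth_atlas_of_riemannian[OF M] p]
    and B = chart_at_mem[OF smooth_atlas_of_riemannian[OF N] smooth_map_topspace[OF smooth p]]
  show ?thesis
    using local_norm_sq_transition[OF assms(1) A(1) assms(2) B(1) assms(3) A(2) assms(4) B(2)]
    by (simp add: norm_differential_sq_def local_norm_sq_def Let_def)
qed

lemma norm_differential_sq_nonneg:
  assumes "c \<in> A" "d \<in> B" "p \<in> chart_dom c" "\<psi> p \<in> chart_dom d"
  shows "norm_differential_sq A B g h \<psi> p \<ge> 0"
proof -
  have "metric_inner (h d (\<psi> p)) v v \<ge> 0" for v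
    using riemannian_manifold_metric(3)[OF N assms(2,4), of v]
    by (cases "v = 0") (auto simp: metric_inner_def)
  then show ?thesis
    \<comment> \<open>Whatever frame the choice inside \<open>metric_trace\<close> returns, each
      summand is a squared length.\<close>
    unfolding norm_differential_sq_eq[OF assms] local_norm_sq_def metric_trace_def Let_def
    by (intro sum_nonneg) auto
qed

text \<open>This is the classical expression g^(kl) h(\<partial>_k \<psi>, \<partial>_l \<psi>),
  free of the chosen frame, whose dependence on the point need not be regular.\<close>

lemma norm_differential_sq_coordinates:
  assumes "c \<in> A" "d \<in> B" "p \<in> chart_dom c" "\<psi> p \<in> chart_dom d"
  shows "norm_differential_sq A B g h \<psi> p = (\<Sum>k\<in>UNIV. \<Sum>l\<in>UNIV. matrix_inv (g c p) $ k $ l *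
    metric_inner (h d (\<psi> p)) (partial_deriv k (local_rep \<psi> c d) (chart_map c p))
      (partial_deriv l (local_rep \<psi> c d) (chart_map c p)))"
proof -
  obtain e where e: "orthonormal_frame (g c p) e"
    using riemannian_orthonormal_frame[OF M] assms by blast
  show ?thesis
    unfolding norm_differential_sq_eq[OF assms] local_norm_sq_def
      metric_trace_eq[OF e bilinear_pullback[OF assms]]
      orthonormal_frame_sum[OF e bilinear_pullback[OF assms]]
    by (simp add: differential_def partial_deriv_def)
qed

text \<open>In fixed coordinates |d\<psi>|^2 is a polynomial in the entries of the inverse of
  \<open>g\<close>, those of \<open>h\<close> along \<psi>, and the first derivatives of \<psi>;
  each of these is differentiable.\<close>

lemma norm_differential_sq_differentiable:
  assumes "c \<in> A" "d \<in> B" "p \<in> chart_dom c" "\<psi> p \<in> chart_dom d"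
  shows "(norm_differential_sq A B g h \<psi> \<circ> chart_inv c) differentiable at (chart_map c p)"
proof -
  let ?x = "chart_map c p" and ?F = "local_rep \<psi> c d"
  let ?V = "{q \<in> chart_dom c. \<psi> q \<in> chart_dom d}"
  let ?U = "chart_map c ` ?V"
  have inv: "chart_inv c (chart_map c q) = q" if "q \<in> chart_dom c" for q
    using chart_inv_chart_map[OF chart_of_domain] assms(1) that by blast
  have invd: "chart_inv d (chart_map d q) = q" if "q \<in> chart_dom d" for q
    using chart_inv_chart_map[OF chart_of_codomain] assms(2) that by blast
  have U: "open ?U" "?x \<in> ?U"
    using assms by (auto intro!: open_local_rep_domain is_chart_openin
        chart_of_domain chart_of_codomain)
  have "local_metric g c differentiable at ?x"
    using smooth_on_differentiable[OF riemannian_manifold_metric(1)[OF M assms(1)]] assms by blast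
  then have ginv: "(\<lambda>y. matrix_inv (local_metric g c y) $ k $ l) differentiable at ?x" for k l
  proof (rule differentiable_matrix_inv[OF _ U])
    show "invertible (local_metric g c y)" if "y \<in> ?U" for y
      using that riemannian_invertible[OF M assms(1)] by (auto simp: local_metric_def inv)
  qed
  have "local_metric h d differentiable at (?F ?x)"
  proof (rule smooth_on_differentiable[OF riemannian_manifold_metric(1)[OF N assms(2)]])
    show "?F ?x \<in> chart_map d ` chart_dom d"
      using assms by (simp add: local_rep_def inv)
  qed
  from differentiable_chain_at[OF local_rep_differentiable[OF assms] this]
  have hF: "(\<lambda>y. local_metric h d (?F y) $ r $ s) differentiable at ?x" for r s
    by (intro differentiable_vec_nth) (simp add: o_def)
  have dF: "(\<lambda>y. partial_deriv k ?F y $ r) differentiable at ?x" for k r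
    by (rule differentiable_vec_nth[OF smooth_on_differentiable[OF
          smooth_on_partial_deriv[OF smooth_on_local_rep[OF assms(1,2)]] U(2)]])
  have "(\<lambda>y. \<Sum>k\<in>UNIV. \<Sum>l\<in>UNIV. matrix_inv (local_metric g c y) $ k $ l *
      (\<Sum>r\<in>UNIV. partial_deriv k ?F y $ r *
        (\<Sum>s\<in>UNIV. local_metric h d (?F y) $ r $ s * partial_deriv l ?F y $ s)))
      differentiable at ?x" (is "?E differentiable _")
    by (intro differentiable_sum ballI differentiable_mult ginv hF dF) auto
  then obtain D where D: "(?E has_derivative D) (at ?x)"
    unfolding differentiable_def by blast
  show ?thesis
  proof (rule differentiableI, rule has_derivative_transform_within_open[OF D U])
    fix y assume "y \<in> ?U"
    then obtain q where q: "q \<in> chart_dom c" "\<psi> q \<in> chart_dom d" "y = chart_map c q" by blast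
    have "?F y = chart_map d (\<psi> q)" using q by (simp add: local_rep_def inv)
    then show "?E y = (norm_differential_sq A B g h \<psi> \<circ> chart_inv c) y"
      using q norm_differential_sq_coordinates[OF assms(1,2) q(1,2)]
      by (simp add: local_metric_def inv invd metric_inner_def inner_vec_def matrix_vector_mult_def)
  qed
qed

end

section \<open>The tension field under a conformal change of the metric\<close>

text \<open>With the frame vectors as columns of \<open>E\<close>, orthonormality reads E^T G E = 1.
  Cycling the factors shows that E E^T is a left inverse of \<open>G\<close>.\<close>

lemma orthonormal_frame_invertible:
  fixes G :: "real^'m::finite^'m"
  assumes "orthonormal_frame G e"
  shows "invertible G"
proof -
  define E :: "real^'m^'m" where "E = (\<chi> k i. e i $ k)"
  have "(transpose E ** (G ** E)) $ i $ j = metric_inner G (e i) (e j)" for i j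
    by (simp add: metric_inner_def E_def transpose_def matrix_matrix_mult_def
        matrix_vector_mult_def inner_vec_def)
  then have "transpose E ** (G ** E) = mat 1"
    using assms by (simp add: vec_eq_iff orthonormal_frame_def mat_def)
  then have "(transpose E ** G) ** E = mat 1" by (simp add: matrix_mul_assoc)
  then have "E ** (transpose E ** G) = mat 1" by (rule iffD1[OF matrix_left_right_inverse])
  then have "(E ** transpose E) ** G = mat 1" by (simp add: matrix_mul_assoc)
  then show ?thesis unfolding invertible_left_inverse by blast
qed

text \<open>Scaling the metric by \<open>r\<close> multiplies lengths by \<open>sqrt r\<close>,
  which the frame has to compensate.\<close>

lemma orthonormal_frame_scaleR:
  assumes "orthonormal_frame G e" "r > 0"
  shows "orthonormal_frame (r *\<^sub>R G) (\<lambda>i. (1 / sqrt r) *\<^sub>R e i)"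
proof -
  have "metric_inner (r *\<^sub>R G) v w = r * metric_inner G v w" for v w
    by (simp add: metric_inner_def scaleR_matrix_vector_assoc[symmetric])
  then show ?thesis
    using assms by (simp add: orthonormal_frame_def metric_inner_scaleR_left
        metric_inner_scaleR_right field_simps)
qed

lemma linear_second_fundamental_form:
  "linear (\<lambda>v. second_fundamental_form g h \<psi> c d p v w)"
  "linear (second_fundamental_form g h \<psi> c d p v)"
  by (rule linearI; simp only: second_fundamental_form_def Let_def vector_add_component
      vector_scaleR_component ring_distribs scaleR_add_left sum.distrib scaleR_sum_right
      scaleR_scaleR mult.assoc mult.left_commute real_scaleR_def)+

text \<open>Two Kronecker deltas collapse the double sum. This evaluates
  \<open>second_fundamental_form\<close> on a pair of coordinate vectors.\<close>

lemma sum_axis_axis: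
  fixes f :: "'m::finite \<Rightarrow> 'm \<Rightarrow> 'b::real_vector"
  shows "(\<Sum>i\<in>UNIV. \<Sum>j\<in>UNIV. ((axis k (1::real) :: real^'m) $ i * (axis l 1 :: real^'m) $ j) *\<^sub>R f i j)
    = f k l"
proof -
  have "(\<Sum>i\<in>UNIV. \<Sum>j\<in>UNIV. ((axis k (1::real) :: real^'m) $ i * (axis l 1 :: real^'m) $ j) *\<^sub>R f i j)
      = (\<Sum>i\<in>UNIV. \<Sum>j\<in>UNIV. if i = k then if j = l then f i j else 0 else 0)"
    by (intro sum.cong refl) (simp add: axis_def)
  also have "\<dots> = (\<Sum>i\<in>UNIV. if i = k then \<Sum>j\<in>UNIV. if j = l then f i j else 0 else 0)"
    by (intro sum.cong refl) simp
  finally show ?thesis by simp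
qed

text \<open>The Christoffel symbols of the domain enter the tension field only through their trace.\<close>

lemma tension_field_coordinates:
  fixes g :: "('p, 'm::finite) metric_tensor" and h :: "('q, 'n::finite) metric_tensor"
    and c :: "('p, 'm) chart" and d :: "('q, 'n) chart" and \<psi> :: "'p \<Rightarrow> 'q" and p :: 'p
  assumes "orthonormal_frame (g c p) e"
  defines "F \<equiv> local_rep \<psi> c d" and "x \<equiv> chart_map c p"
  shows "tension_field g h \<psi> c d p =
    (\<Sum>i\<in>UNIV. \<Sum>j\<in>UNIV. matrix_inv (g c p) $ i $ j *\<^sub>R
      (partial_deriv i (partial_deriv j F) x
       + (\<chi> r. \<Sum>s\<in>UNIV. \<Sum>t\<in>UNIV.
            christoffel h d (\<psi> p) r s t * partial_deriv i F x $ s * partial_deriv j F x $ t)))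
    - (\<Sum>k\<in>UNIV. (\<Sum>i\<in>UNIV. \<Sum>j\<in>UNIV. matrix_inv (g c p) $ i $ j * christoffel g c p k i j)
        *\<^sub>R partial_deriv k F x)" (is "_ = ?P - ?Q")
proof -
  \<comment> \<open>The sum over \<open>k\<close> is moved inside the trace, to match the last term
    of the second fundamental form.\<close>
  have "?Q = (\<Sum>k\<in>UNIV. \<Sum>i\<in>UNIV. \<Sum>j\<in>UNIV.
      matrix_inv (g c p) $ i $ j *\<^sub>R (christoffel g c p k i j *\<^sub>R partial_deriv k F x))"
    by (simp add: scaleR_sum_left)
  also have "\<dots> = (\<Sum>i\<in>UNIV. \<Sum>j\<in>UNIV. \<Sum>k\<in>UNIV.
      matrix_inv (g c p) $ i $ j *\<^sub>R (christoffel g c p k i j *\<^sub>R partial_deriv k F x))"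
    by (subst sum.swap, rule sum.cong[OF refl], rule sum.swap)
  finally have Q: "?Q = (\<Sum>i\<in>UNIV. \<Sum>j\<in>UNIV. matrix_inv (g c p) $ i $ j *\<^sub>R
      (\<Sum>k\<in>UNIV. christoffel g c p k i j *\<^sub>R partial_deriv k F x))"
    by (simp add: scaleR_sum_right)
  note lin = linear_second_fundamental_form[of g h \<psi> c d p]
  show ?thesis
    unfolding Q tension_field_def metric_trace_eq[OF assms(1) lin]
      orthonormal_frame_sum[OF assms(1) lin]
    by (simp add: second_fundamental_form_def Let_def sum_axis_axis F_def x_def
        scaleR_diff_right sum_subtractf)
qed

section \<open>Christoffel symbols and their trace under a conformal change\<close>

lemma symmetric_matrix_nth: "transpose G = G \<Longrightarrow> G $ i $ j = G $ j $ i"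
  by (drule arg_cong[where f = "\<lambda>M. M $ j $ i"]) (simp add: transpose_def)

text \<open>By the product rule each derivative of \<rho> g splits in two. The terms with
  derivatives of \<open>g\<close> carry a factor \<rho>, which the inverse metric cancels, and
  restore the old symbol. The terms with derivatives of \<rho> contract with the inverse metric to
  two Kronecker deltas and a gradient.\<close>

lemma christoffel_conformal:
  fixes g :: "('p, 'm::finite) metric_tensor" and c :: "('p, 'm) chart" and p :: 'p
    and \<rho> :: "'p \<Rightarrow> real"
  assumes inv: "chart_inv c (chart_map c p) = p"
    and sym: "transpose (g c p) = g c p" and "invertible (g c p)"
    and g: "local_metric g c differentiable at (chart_map c p)"
    and \<rho>: "(\<rho> \<circ> chart_inv c) differentiable at (chart_map c p)" and "\<rho> p > 0"
  defines "R \<equiv> \<lambda>i. partial_deriv i (\<rho> \<circ> chart_inv c) (chart_map c p)"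
  shows "christoffel (conformal_metric \<rho> g) c p k i j = christoffel g c p k i j
    + (1 / (2 * \<rho> p)) * ((if k = j then R i else 0) + (if k = i then R j else 0)
        - gradient g \<rho> c p $ k * g c p $ i $ j)"
proof -
  let ?x = "chart_map c p" and ?H = "matrix_inv (g c p)"
  let ?D = "\<lambda>i j l. partial_deriv i (\<lambda>y. local_metric g c y $ j $ l) ?x"
  have D: "partial_deriv i (\<lambda>y. local_metric (conformal_metric \<rho> g) c y $ j $ l) ?x
      = R i * g c p $ j $ l + \<rho> p * ?D i j l" for i j l
  proof -
    obtain R' where R': "((\<rho> \<circ> chart_inv c) has_derivative R') (at ?x)"
      using \<rho> unfolding differentiable_def by blast
    obtain D' where D': "((\<lambda>y. local_metric g c y $ j $ l) has_derivative D') (at ?x)"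
      using differentiable_vec_nth[OF differentiable_vec_nth[OF g]]
      unfolding differentiable_def by blast
    have "((\<lambda>y. local_metric (conformal_metric \<rho> g) c y $ j $ l) has_derivative
        (\<lambda>v. \<rho> p * D' v + R' v * g c p $ j $ l)) (at ?x)"
      using has_derivative_mult[OF R' D']
      by (simp add: local_metric_def conformal_metric_def inv)
    from partial_deriv_eq[OF this] show ?thesis
      by (simp add: R_def partial_deriv_eq[OF R'] partial_deriv_eq[OF D'])
  qed
  have gsym: "g c p $ i $ j = g c p $ j $ i" for i j
    by (rule symmetric_matrix_nth[OF sym])
  have Hg: "(\<Sum>l\<in>UNIV. ?H $ k $ l * g c p $ l $ j) = (if k = j then 1 else 0)" for k j
    using matrix_inv_left[OF assms(3)]
    by (simp add: vec_eq_iff matrix_matrix_mult_def mat_def)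
  have Hg': "(\<Sum>l\<in>UNIV. ?H $ k $ l * (r * g c p $ j $ l)) = (if k = j then r else 0)" for k j r
    using Hg[of k j] by (simp add: gsym[of j] mult.left_commute sum_distrib_left[symmetric])
  have HR: "(\<Sum>l\<in>UNIV. ?H $ k $ l * (R l * r)) = gradient g \<rho> c p $ k * r" for r
    by (simp add: gradient_def R_def matrix_vector_mult_def sum_distrib_right mult.assoc)
  have Hinv: "matrix_inv (conformal_metric \<rho> g c p) = (1 / \<rho> p) *\<^sub>R ?H"
    unfolding conformal_metric_def using assms by (intro matrix_inv_scaleR) auto
  \<comment> \<open>The summand is sorted into the shapes to which the contractions
    \<open>Hg'\<close> and \<open>HR\<close> apply.\<close>
  have "christoffel (conformal_metric \<rho> g) c p k i j
      = (1 / (2 * \<rho> p)) * (\<Sum>l\<in>UNIV. ?H $ k $ l * (R i * g c p $ j $ l) + ?H $ k $ l * (R j * g c p $ i $ l)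
          - ?H $ k $ l * (R l * g c p $ i $ j) + \<rho> p * (?H $ k $ l * (?D i j l + ?D j i l - ?D l i j)))"
    unfolding christoffel_def Let_def D Hinv sum_distrib_left
    by (intro sum.cong refl) (simp add: algebra_simps add_divide_distrib diff_divide_distrib)
  also have "\<dots> = (1 / (2 * \<rho> p)) * ((if k = j then R i else 0) + (if k = i then R j else 0)
        - gradient g \<rho> c p $ k * g c p $ i $ j
        + \<rho> p * (\<Sum>l\<in>UNIV. ?H $ k $ l * (?D i j l + ?D j i l - ?D l i j)))"
    unfolding sum.distrib sum_subtractf Hg' HR sum_distrib_left[symmetric] ..
  finally show ?thesis
    using \<open>\<rho> p > 0\<close> by (simp add: christoffel_def Let_def field_simps)
qed

text \<open>Tracing the correction, each Kronecker delta contributes the gradient once, and the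
  trace of \<open>g\<close> against its own inverse is the dimension m. The total is 2 - m
  gradients, divided by 2 \<rho>.\<close>

lemma trace_christoffel_conformal:
  fixes g :: "('p, 'm::finite) metric_tensor" and c :: "('p, 'm) chart" and p :: 'p
    and \<rho> :: "'p \<Rightarrow> real"
  assumes "chart_inv c (chart_map c p) = p"
    and sym: "transpose (g c p) = g c p" and inv: "invertible (g c p)"
    and "local_metric g c differentiable at (chart_map c p)"
    and "(\<rho> \<circ> chart_inv c) differentiable at (chart_map c p)" and "\<rho> p > 0"
  defines "H \<equiv> matrix_inv (g c p)"
  shows "(\<Sum>i\<in>UNIV. \<Sum>j\<in>UNIV. H $ i $ j * christoffel (conformal_metric \<rho> g) c p k i j)
    = (\<Sum>i\<in>UNIV. \<Sum>j\<in>UNIV. H $ i $ j * christoffel g c p k i j)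
      - ((real CARD('m) - 2) / (2 * \<rho> p)) * gradient g \<rho> c p $ k"
proof -
  let ?R = "\<lambda>i. partial_deriv i (\<rho> \<circ> chart_inv c) (chart_map c p)"
  let ?g = "gradient g \<rho> c p $ k"
  have gsym: "g c p $ i $ j = g c p $ j $ i" for i j
    by (rule symmetric_matrix_nth[OF sym])
  \<comment> \<open>The transpose of the inverse is an inverse of the symmetric matrix
    \<open>g c p\<close>, hence equal to \<open>H\<close>. The symmetry is needed for the first
    Kronecker term below, where the sum runs over the first index of \<open>H\<close>.\<close>
  have "transpose H = H"
    unfolding H_def
    by (rule matrix_inv_unique[symmetric])
      (metis inv matrix_inv_left matrix_transpose_mul sym transpose_mat)
  then have Hsym: "H $ i $ j = H $ j $ i" for i j
    by (rule symmetric_matrix_nth)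
  have Hg: "(\<Sum>l\<in>UNIV. H $ k $ l * g c p $ l $ j) = (if k = j then 1 else 0)" for k j
    using matrix_inv_left[OF inv]
    by (simp add: H_def vec_eq_iff matrix_matrix_mult_def mat_def)
  have grad: "?g = (\<Sum>l\<in>UNIV. H $ k $ l * ?R l)"
    by (simp add: gradient_def H_def matrix_vector_mult_def)
  have 1: "(\<Sum>i\<in>UNIV. \<Sum>j\<in>UNIV. H $ i $ j * (if k = j then ?R i else 0)) = ?g"
    by (simp add: grad if_distrib[of "(*) _"] Hsym cong: if_cong)
  have 2: "(\<Sum>i\<in>UNIV. \<Sum>j\<in>UNIV. H $ i $ j * (if k = i then ?R j else 0)) = ?g"
    by (subst sum.swap) (simp add: grad if_distrib[of "(*) _"] cong: if_cong)
  have "(\<Sum>i\<in>UNIV. \<Sum>j\<in>UNIV. H $ i $ j * g c p $ i $ j) = real CARD('m)"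
    using Hg by (simp add: gsym)
  then have 3: "(\<Sum>i\<in>UNIV. \<Sum>j\<in>UNIV. H $ i $ j * (?g * g c p $ i $ j)) = ?g * real CARD('m)"
    by (simp only: mult.left_commute[of _ ?g] sum_distrib_left[symmetric])
  have "(\<Sum>i\<in>UNIV. \<Sum>j\<in>UNIV. H $ i $ j * christoffel (conformal_metric \<rho> g) c p k i j)
    = (\<Sum>i\<in>UNIV. \<Sum>j\<in>UNIV. H $ i $ j * christoffel g c p k i j + (1 / (2 * \<rho> p)) *
        (H $ i $ j * (if k = j then ?R i else 0) + H $ i $ j * (if k = i then ?R j else 0)
         - H $ i $ j * (?g * g c p $ i $ j)))"
    unfolding christoffel_conformal[OF assms(1-6)]
    by (intro sum.cong refl) (simp only: ring_distribs mult.left_commute)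
  also have "\<dots> = (\<Sum>i\<in>UNIV. \<Sum>j\<in>UNIV. H $ i $ j * christoffel g c p k i j)
      + (1 / (2 * \<rho> p)) * (?g + ?g - ?g * real CARD('m))"
    unfolding sum.distrib sum_distrib_left[symmetric] sum_subtractf 1 2 3 ..
  finally show ?thesis
    by (simp add: algebra_simps add_divide_distrib diff_divide_distrib)
qed

text \<open>In the coordinate formula the inverse metric gains the factor 1/\<rho>, and the trace of
  the Christoffel symbols drops by a multiple of the gradient of \<rho>. That trace enters with a
  minus sign, so the gradient term is added.\<close>

lemma tension_field_conformal:
  fixes g :: "('p, 'm::finite) metric_tensor" and h :: "('q, 'n::finite) metric_tensor"
  assumes "chart_inv c (chart_map c p) = p"
    and "transpose (g c p) = g c p" and e: "orthonormal_frame (g c p) e"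
    and "local_metric g c differentiable at (chart_map c p)"
    and "(\<rho> \<circ> chart_inv c) differentiable at (chart_map c p)" and \<rho>: "\<rho> p > 0"
    and lin: "linear (differential \<psi> c d p)"
  shows "tension_field (conformal_metric \<rho> g) h \<psi> c d p = (1 / \<rho> p) *\<^sub>R
    (tension_field g h \<psi> c d p
     + ((real CARD('m) - 2) / (2 * \<rho> p)) *\<^sub>R differential \<psi> c d p (gradient g \<rho> c p))"
proof -
  let ?H = "matrix_inv (g c p)" and ?F = "local_rep \<psi> c d" and ?x = "chart_map c p"
  have inv: "invertible (g c p)" by (rule orthonormal_frame_invertible[OF e])
  have Hinv: "matrix_inv (conformal_metric \<rho> g c p) = (1 / \<rho> p) *\<^sub>R ?H"
    unfolding conformal_metric_def using \<rho> by (intro matrix_inv_scaleR inv) auto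
  have e': "orthonormal_frame (conformal_metric \<rho> g c p) (\<lambda>i. (1 / sqrt (\<rho> p)) *\<^sub>R e i)"
    unfolding conformal_metric_def by (rule orthonormal_frame_scaleR[OF e \<rho>])
  \<comment> \<open>Written in coordinate derivatives, d\<psi> of the gradient has the form of the
    sum that the Christoffel correction leaves behind.\<close>
  have "differential \<psi> c d p v = (\<Sum>k\<in>UNIV. v $ k *\<^sub>R partial_deriv k ?F ?x)" for v
  proof -
    have "differential \<psi> c d p v = differential \<psi> c d p (\<Sum>k\<in>UNIV. v $ k *\<^sub>R axis k 1)"
      using basis_expansion[of v] by (simp add: scalar_mult_eq_scaleR)
    then have "differential \<psi> c d p v = (\<Sum>k\<in>UNIV. v $ k *\<^sub>R differential \<psi> c d p (axis k 1))"
      by (simp only: linear_sum[OF lin] linear_cmul[OF lin])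
    then show ?thesis by (simp add: differential_def partial_deriv_def)
  qed
  note d\<psi> = this
  note trace = trace_christoffel_conformal[where \<rho> = \<rho>, OF assms(1,2) inv assms(4-6)]
  let ?c = "(real CARD('m) - 2) / (2 * \<rho> p)" and ?dF = "\<lambda>k. partial_deriv k ?F ?x"
  let ?\<Gamma> = "\<lambda>k. \<Sum>i\<in>UNIV. \<Sum>j\<in>UNIV. ?H $ i $ j * christoffel g c p k i j"
  have tr: "(\<Sum>i\<in>UNIV. \<Sum>j\<in>UNIV. ((1 / \<rho> p) *\<^sub>R ?H) $ i $ j
        * christoffel (conformal_metric \<rho> g) c p k i j)
      = (1 / \<rho> p) * (?\<Gamma> k - ?c * gradient g \<rho> c p $ k)" for k
    unfolding trace[symmetric] by (simp add: sum_distrib_left)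
  have P: "(\<Sum>i\<in>UNIV. \<Sum>j\<in>UNIV. ((1 / \<rho> p) *\<^sub>R ?H) $ i $ j *\<^sub>R P i j)
      = (1 / \<rho> p) *\<^sub>R (\<Sum>i\<in>UNIV. \<Sum>j\<in>UNIV. ?H $ i $ j *\<^sub>R P i j)"
    for P :: "'m \<Rightarrow> 'm \<Rightarrow> real^'n"
    by (simp add: scaleR_sum_right)
  have Q: "(\<Sum>k\<in>UNIV. ((1 / \<rho> p) * (?\<Gamma> k - ?c * gradient g \<rho> c p $ k)) *\<^sub>R ?dF k)
      = (1 / \<rho> p) *\<^sub>R ((\<Sum>k\<in>UNIV. ?\<Gamma> k *\<^sub>R ?dF k)
          - ?c *\<^sub>R (\<Sum>k\<in>UNIV. gradient g \<rho> c p $ k *\<^sub>R ?dF k))"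
    by (simp only: scaleR_scaleR[symmetric] scaleR_sum_right[symmetric] scaleR_diff_left
        sum_subtractf)
  show ?thesis
    unfolding tension_field_coordinates[where g = g, OF e]
      tension_field_coordinates[where g = "conformal_metric \<rho> g", OF e'] Hinv d\<psi> tr P Q
    by (simp only: scaleR_diff_right scaleR_add_right diff_diff_eq2 add_diff_eq diff_add_eq)
qed

text \<open>Chain rule for a constant exponent. It serves twice: for the weight as a power of 1 +
  |d\<psi>|^2, where only differentiability is used, and for the conformal factor as a power of the
  weight.\<close>

lemma gradient_powr:
  assumes "(w \<circ> chart_inv c) differentiable at (chart_map c p)"
    and "chart_inv c (chart_map c p) = p" and "w p > 0"
  shows "((\<lambda>p. w p powr a) \<circ> chart_inv c) differentiable at (chart_map c p)"
    and "gradient g (\<lambda>p. w p powr a) c p = (a * w p powr a / w p) *\<^sub>R gradient g w c p"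
proof -
  obtain D where D: "((w \<circ> chart_inv c) has_derivative D) (at (chart_map c p))"
    using assms(1) unfolding differentiable_def by blast
  have P: "(((\<lambda>p. w p powr a) \<circ> chart_inv c) has_derivative
      (\<lambda>v. (a * w p powr a / w p) * D v)) (at (chart_map c p))"
    using has_derivative_powr[OF D has_derivative_const[of a]] assms
    by (simp add: o_def mult_ac)
  then show "((\<lambda>p. w p powr a) \<circ> chart_inv c) differentiable at (chart_map c p)"
    by (rule differentiableI)
  have "(\<chi> i. partial_deriv i ((\<lambda>p. w p powr a) \<circ> chart_inv c) (chart_map c p))
      = (a * w p powr a / w p) *\<^sub>R (\<chi> i. partial_deriv i (w \<circ> chart_inv c) (chart_map c p))"
    by (simp add: vec_eq_iff partial_deriv_eq[OF P] partial_deriv_eq[OF D])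
  then show "gradient g (\<lambda>p. w p powr a) c p = (a * w p powr a / w p) *\<^sub>R gradient g w c p"
    unfolding gradient_def by (simp add: matrix_vector_mult_scaleR)
qed

section \<open>The conformal factor as a power of the \<alpha>-weight\<close>

theorem proposition3:
  fixes \<alpha> :: real
    and X :: "'p topology" and A :: "('p, 'm::finite) chart set" and g :: "('p, 'm) metric_tensor"
    and Y :: "'q topology" and B :: "('q, 'n::finite) chart set" and h :: "('q, 'n) metric_tensor"
    and \<psi> :: "'p \<Rightarrow> 'q"
  assumes "\<alpha> > 1"
    and "CARD('m) > 2"
    and "riemannian_manifold X A g"
    and "compact_space X"
    and "orientable X A"
    and "riemannian_manifold Y B h"
    and "smooth_map X A Y B \<psi>"
    and "nondegenerate A B \<psi>"
  defines "gbar \<equiv> conformal_metric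
      (\<lambda>p. (2 * \<alpha>) powr (2 / (real CARD('m) - 2)) *
           (1 + norm_differential_sq A B g h \<psi> p) powr ((2 * \<alpha> - 2) / (real CARD('m) - 2))) g"
  shows "alpha_harmonic \<alpha> A B g h \<psi> \<longleftrightarrow> harmonic A B gbar h \<psi>"
proof -
  note M = assms(3) and N = assms(6) and S = assms(7)
  define w where "w = alpha_weight \<alpha> A B g h \<psi>"
  \<comment> \<open>The exponent for which \<open>w powr a\<close> is the prescribed factor: the
    constant 2\<alpha> receives 2/(m-2), and \<alpha> - 1 becomes (2\<alpha> - 2)/(m-2).\<close>
  define a where "a = 2 / (real CARD('m) - 2)"
  define \<rho> where "\<rho> = (\<lambda>p. w p powr a)"
  have gbar: "gbar = conformal_metric \<rho> g"
    unfolding gbar_def \<rho>_def w_def a_def alpha_weight_def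
    by (simp add: powr_mult powr_powr algebra_simps)
  \<comment> \<open>A pointwise identity stronger than the equivalence: the two fields differ by a
    positive factor, so they vanish together.\<close>
  have "tension_field gbar h \<psi> c d p
      = (1 / (\<rho> p * w p)) *\<^sub>R alpha_tension_field \<alpha> A B g h \<psi> c d p \<and> \<rho> p * w p > 0"
    if cd: "c \<in> A" "d \<in> B" and p: "p \<in> chart_dom c" "\<psi> p \<in> chart_dom d" for c d p
  proof -
    let ?x = "chart_map c p"
    have inv: "chart_inv c ?x = p"
      by (rule chart_inv_chart_map[OF chart_of_domain[OF M N S cd(1)] p(1)])
    have pos: "1 + norm_differential_sq A B g h \<psi> p > 0"
      using norm_differential_sq_nonneg[OF M N S cd p] by simp
    then have w: "w p > 0"
      using \<open>\<alpha> > 1\<close> by (simp add: w_def alpha_weight_def)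
    then have \<rho>: "\<rho> p > 0" by (simp add: \<rho>_def)
    obtain D where D: "(norm_differential_sq A B g h \<psi> \<circ> chart_inv c has_derivative D) (at ?x)"
      using norm_differential_sq_differentiable[OF M N S cd p] unfolding differentiable_def by blast
    have 1: "((\<lambda>p. 1 + norm_differential_sq A B g h \<psi> p) \<circ> chart_inv c) differentiable at ?x"
      using has_derivative_add[OF has_derivative_const[of 1] D]
      by (auto simp: o_def intro: differentiableI)
    have w': "(w \<circ> chart_inv c) differentiable at ?x"
      using gradient_powr(1)[OF 1 inv pos, where a = "\<alpha> - 1"] \<open>\<alpha> > 1\<close>
      by (simp add: w_def alpha_weight_def[abs_def] o_def)
    note \<rho>' = gradient_powr(1)[OF w' inv w, where a = a, folded \<rho>_def]
      gradient_powr(2)[OF w' inv w, where a = a and g = g, folded \<rho>_def]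
    have g': "local_metric g c differentiable at ?x"
      using smooth_on_differentiable[OF riemannian_manifold_metric(1)[OF M cd(1)]] p by blast
    obtain e where e: "orthonormal_frame (g c p) e"
      using riemannian_orthonormal_frame[OF M cd(1) p(1)] by blast
    note lin = linear_differential[OF M N S cd p]
    \<comment> \<open>Since m > 2, the factor m - 2 is nonzero and cancels against \<open>a\<close>,
      and \<rho> cancels against \<open>w powr a\<close>. What remains is the logarithmic derivative
      factor of the weight, exactly as in the \<alpha>-tension field divided by
      \<open>w\<close>.\<close>
    have coeff: "(real CARD('m) - 2) / (2 * \<rho> p) * (a * w p powr a / w p) = 1 / w p"
      using w \<open>CARD('m) > 2\<close> by (simp add: \<rho>_def a_def)
    have "tension_field gbar h \<psi> c d p = (1 / \<rho> p) *\<^sub>R (tension_field g h \<psi> c d p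
        + (1 / w p) *\<^sub>R differential \<psi> c d p (gradient g w c p))"
      unfolding gbar tension_field_conformal[where \<rho> = \<rho>, OF inv
          riemannian_manifold_metric(2)[OF M cd(1) p(1)] e g' \<rho>'(1) \<rho> lin]
        \<rho>'(2) linear_cmul[OF lin] scaleR_scaleR coeff ..
    then show ?thesis
      using \<rho> w by (simp add: alpha_tension_field_def w_def[symmetric] scaleR_add_right)
  qed
  then show ?thesis
    unfolding alpha_harmonic_def harmonic_def
    by (metis divide_eq_0_iff less_irrefl scaleR_eq_0_iff zero_neq_one)
qed

end
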